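(* For each $n\in\{1,2\}$ the Suffridge polynomial $S_{n,1}$ is extremal in $\mathcal U_n$ for Dimitrov's problem, i.e. $$\min_{|z|=1}|S_{n,1}(z)|=\inf_{p\in\mathcal U_n}\ \min_{|z|=1}|p(z)|.$$ For each $n\in\{3,4,5,6\}$ the Suffridge polynomial $S_{n,1}$ is not extremal: there exists $p\in\mathcal U_n$ such that $$\min_{|z|=1}|p(z)|<\min_{|z|=1}|S_{n,1}(z)|.$$
   Context: Let $\mathbb D=\{z\in\mathbb C:|z|<1\}$. For a positive integer $n$, $\mathcal U_n$ denotes the set of complex polynomials $p$ of degree $n$ with $p(0)=0$, $p'(0)=1$ that are univalent (injective) in $\mathbb D$. Dimitrov's problem: for each $n$, find a polynomial $p_n\in\mathcal U_n$ for which the infimum over $p\in\mathcal U_n$ of $\inf\{|p(z)|: z=e^{it},\ 0\le t\le 2\pi\}$ is attained; such a polynomial is called extremal. The (first) Suffridge polynomial of degree $n$ is $$S_{n,1}(z)=\sum_{k=1}^n\left(1-\frac{k-1}{n}\right)\frac{\sin(\pi k/(n+1))}{\sin(\pi/(n+1))}\,z^k,$$ which belongs to $\mathcal U_n$. *)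

theory Defs
  imports "HOL-Analysis.Analysis" "HOL-Computational_Algebra.Polynomial"
begin

definition univalent_polys :: "nat \<Rightarrow> complex poly set" where
  "univalent_polys n =
     {p. degree p = n \<and> poly p 0 = 0 \<and> poly (pderiv p) 0 = 1 \<and> inj_on (poly p) (ball 0 1)}"

(* The infimum is a minimum, the unit circle being compact. *)
definition min_on_circle :: "complex poly \<Rightarrow> real" where
  "min_on_circle p = (INF z\<in>sphere 0 1. cmod (poly p z))"

definition dimitrov_extremal :: "nat \<Rightarrow> complex poly \<Rightarrow> bool" where
  "dimitrov_extremal n p \<longleftrightarrow>
     p \<in> univalent_polys n \<and> min_on_circle p = (INF q\<in>univalent_polys n. min_on_circle q)"

definition suffridge_poly :: "nat \<Rightarrow> complex poly" where
  "suffridge_poly n =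
     (\<Sum>k=1..n. monom (complex_of_real
        ((1 - (real k - 1) / real n) * (sin (pi * real k / (real n + 1)) / sin (pi / (real n + 1))))) k)"

end

theory Submission
  imports Defs "HOL-Complex_Analysis.Complex_Analysis"
begin

text \<open>
  For \<open>n = 2\<close> univalence of \<open>z + a z\<^sup>2\<close> forces \<open>\<bar>a\<bar> \<le> 1/2\<close>, and the minimum is at least \<open>1 - \<bar>a\<bar>\<close>.

  For \<open>n \<ge> 3\<close> an explicit univalent competitor \<open>p\<close> with \<open>\<bar>p(-1)\<bar>\<close> below the minimum of the
  Suffridge polynomial suffices. The cubic competitor is handled by hand. For \<open>n = 4, 5, 6\<close>, \<open>p\<close> is
  close-to-convex with respect to the map \<open>g\<close> of the disc onto a vertical strip with
  \<open>g' = 1 / (1 - 2cz + z\<^sup>2)\<close>: since \<open>1 - 2cz + z\<^sup>2 = 2(x - c)z\<close> for \<open>\<bar>z\<bar> = 1\<close>, \<open>x = Re z\<close>, the condition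
  \<open>Re (p'/g') > 0\<close> follows if \<open>Re (z p'(z)) = (x - c) r(x)\<close> on the circle with \<open>r \<ge> 0\<close> on \<open>[-1, 1]\<close>.
  Conversely every such \<open>r\<close> yields a competitor once \<open>c\<close> is chosen to make the mean of \<open>(x - c) r(x)\<close>
  over the circle vanish; \<open>r\<close> is taken with roots near those of the numerical optimum.
\<close>

section \<open>A univalence criterion\<close>

text \<open>Noshiro-Warschawski: along the segment from \<open>a\<close> to \<open>b\<close> the
  real part of \<open>cnj (b - a) * f\<close> has derivative \<open>cmod (b - a)^2 * Re f'\<close>,
  so it strictly increases and the end values differ.\<close>

lemma inj_on_convex_Re_deriv_pos:
  fixes f :: "complex \<Rightarrow> complex"
  assumes "convex S"
    and deriv: "\<And>z. z \<in> S \<Longrightarrow> (f has_field_derivative f' z) (at z)"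
    and pos: "\<And>z. z \<in> S \<Longrightarrow> 0 < Re (f' z)"
  shows "inj_on f S"
proof (rule inj_onI, rule ccontr)
  fix a b assume ab: "a \<in> S" "b \<in> S" "f a = f b" "a \<noteq> b"
  define \<gamma> where "\<gamma> = (\<lambda>t. a + complex_of_real t * (b - a))"
  define g where "g = (\<lambda>t. Re (cnj (b - a) * f (\<gamma> t)))"
  have "g 0 < g 1"
  proof (rule DERIV_pos_imp_increasing[where f = g])
    fix t :: real assume t: "0 \<le> t" "t \<le> 1"
    have "\<gamma> t = (1 - t) *\<^sub>R a + t *\<^sub>R b"
      by (simp add: \<gamma>_def scaleR_conv_of_real algebra_simps)
    then have "\<gamma> t \<in> S"
      using convexD[OF \<open>convex S\<close> ab(1,2), of "1 - t" t] t by simp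
    have "((\<lambda>t. a + t * (b - a)) has_field_derivative (b - a)) (at (of_real t))"
      by (auto intro!: derivative_eq_intros)
    then have "((\<lambda>t. f (a + t * (b - a))) has_field_derivative f' (\<gamma> t) * (b - a)) (at (of_real t))"
      using DERIV_chain2[of f "f' (\<gamma> t)" "\<lambda>t. a + t * (b - a)" "of_real t"]
        deriv[OF \<open>\<gamma> t \<in> S\<close>] unfolding \<gamma>_def by blast
    then have "((\<lambda>t. cnj (b - a) * f (a + t * (b - a))) has_field_derivative
        cnj (b - a) * (f' (\<gamma> t) * (b - a))) (at (of_real t))"
      by (rule DERIV_cmult)
    then have "(g has_real_derivative Re (cnj (b - a) * (f' (\<gamma> t) * (b - a)))) (at t)"
      unfolding g_def \<gamma>_def has_real_derivative_iff_has_vector_derivative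
      by (rule bounded_linear.has_vector_derivative[OF bounded_linear_Re has_vector_derivative_real_field])
    moreover have "Re (cnj (b - a) * (f' (\<gamma> t) * (b - a))) = (cmod (b - a))\<^sup>2 * Re (f' (\<gamma> t))"
      by (simp add: cmod_power2) (simp add: power2_eq_square algebra_simps)
    ultimately have "(g has_real_derivative (cmod (b - a))\<^sup>2 * Re (f' (\<gamma> t))) (at t)"
      by simp
    moreover have "0 < (cmod (b - a))\<^sup>2 * Re (f' (\<gamma> t))"
      using ab(4) pos[OF \<open>\<gamma> t \<in> S\<close>] by simp
    ultimately show "\<exists>y. (g has_real_derivative y) (at t) \<and> 0 < y"
      by blast
  qed simp
  then show False
    using ab(3) by (simp add: g_def \<gamma>_def)
qed

text \<open>The maximum modulus principle for \<open>exp (- f)\<close> gives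
  \<open>0 \<le> Re f\<close> in the disc. The open mapping theorem makes this strict unless
  \<open>f\<close> is constant there, in which case the value at \<open>0\<close> decides.\<close>

lemma Re_pos_of_sphere_nonneg:
  assumes hol: "f holomorphic_on UNIV"
    and "0 < Re (f 0)"
    and sphere: "\<And>z. cmod z = 1 \<Longrightarrow> 0 \<le> Re (f z)"
    and z: "cmod z < 1"
  shows "0 < Re (f z)"
proof -
  have nonneg: "0 \<le> Re (f w)" if w: "w \<in> ball 0 1" for w
  proof -
    have "norm (exp (- f w)) \<le> 1"
    proof (rule maximum_modulus_frontier[where S = "ball 0 1" and f = "\<lambda>z. exp (- f z)"])
      have h: "(\<lambda>z. exp (- f z)) holomorphic_on UNIV"
        using hol by (intro holomorphic_intros)
      show "(\<lambda>z. exp (- f z)) holomorphic_on interior (ball 0 1)"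
        using h by (rule holomorphic_on_subset) simp
      show "continuous_on (closure (ball 0 1)) (\<lambda>z. exp (- f z))"
        by (rule holomorphic_on_imp_continuous_on) (rule holomorphic_on_subset[OF h], simp)
    qed (use sphere w in \<open>auto simp: frontier_ball\<close>)
    then show ?thesis by simp
  qed
  show ?thesis
  proof (cases "f constant_on ball 0 1")
    case True
    then have "f z = f 0"
      using z unfolding constant_on_def by (metis centre_in_ball dist_0_norm mem_ball zero_less_one)
    then show ?thesis using assms(2) by simp
  next
    case False
    then have "open (f ` ball 0 1)"
      using open_mapping_thm[of f "ball 0 1" "ball 0 1"] holomorphic_on_subset[OF hol] by auto
    then obtain e where e: "e > 0" "ball (f z) e \<subseteq> f ` ball 0 1"
      using z by (metis dist_0_norm image_eqI mem_ball open_contains_ball)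
    have "f z - of_real (e/2) \<in> ball (f z) e"
      using e(1) by (simp add: dist_norm)
    then obtain w where "w \<in> ball 0 1" "f w = f z - of_real (e/2)"
      using e(2) by (metis image_iff subsetD)
    then show ?thesis using nonneg[of w] e(1) by simp
  qed
qed

text \<open>Composing \<open>p\<close> with the inverse of the strip map turns its derivative into
  \<open>(1 - 2cz + z^2) p'(z)\<close>, whose real part is positive. The composite is therefore
  injective on the convex strip, and the strip covers the whole disc.\<close>

lemma inj_on_disc_of_strip_map:
  fixes p p' :: "complex \<Rightarrow> complex" and c :: real
  assumes c: "\<bar>c\<bar> < 1"
    and deriv: "\<And>z. cmod z < 1 \<Longrightarrow> (p has_field_derivative p' z) (at z)"
    and pos: "\<And>z::complex. cmod z < 1 \<Longrightarrow> 0 < Re ((1 - 2 * c * z + z\<^sup>2) * p' z)"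
  shows "inj_on p (ball 0 1)"
proof -
  \<comment> \<open>\<open>e\<close> and \<open>cnj e\<close> will be the zeros of
    \<open>1 - 2cz + z^2\<close>, both on the unit circle.\<close>
  define s where "s = sqrt (1 - c\<^sup>2)"
  define e where "e = Complex c s"
  have c2: "c\<^sup>2 < 1" using c by (simp add: abs_square_less_1)
  have s: "0 < s" "s\<^sup>2 = 1 - c\<^sup>2" using c2 by (simp_all add: s_def)
  have e0: "e \<noteq> 0" using s(1) by (simp add: e_def complex_eq_iff)
  have ne: "cmod e = 1" using s(2) by (simp add: e_def cmod_def)
  have ee: "e * cnj e = 1" using ne by (simp add: complex_norm_square[symmetric])
  have ec: "e + cnj e = 2 * c" by (simp add: e_def complex_add_cnj)
  define k where "k = 2 * \<i> * s"
  have k0: "k \<noteq> 0" using s(1) by (simp add: k_def)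
  have ek: "e - cnj e = k" by (simp add: e_def k_def complex_eq_iff)
  have e1: "e\<^sup>2 \<noteq> 1"
  proof
    assume "e\<^sup>2 = 1"
    then have "e * (e - cnj e) = 0" using ee by (simp add: power2_eq_square algebra_simps)
    then show False using e0 ek k0 by simp
  qed
  \<comment> \<open>The Moebius map of the right half-plane onto the disc that sends
    \<open>0\<close> to \<open>e\<close> and infinity to \<open>cnj e\<close>.\<close>
  define h where "h = (\<lambda>v. (e - \<i> * v) / (1 - \<i> * e * v))"
  \<comment> \<open>The sign of \<open>Re v\<close> decides whether \<open>h v\<close> lies in the
    disc; this serves both the inclusion and, further down, surjectivity.\<close>
  have norms: "(cmod (e - \<i> * v))\<^sup>2 - (cmod (1 - \<i> * e * v))\<^sup>2 = - 4 * s * Re v" for v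
  proof -
    have "(c + Im v)\<^sup>2 + (s - Re v)\<^sup>2 - ((1 + (c * Im v + s * Re v))\<^sup>2 + (c * Re v - s * Im v)\<^sup>2)
      = (c\<^sup>2 + s\<^sup>2 - 1) * (1 - (Re v)\<^sup>2 - (Im v)\<^sup>2) - 4 * s * Re v"
      by (simp add: power2_eq_square algebra_simps)
    then show ?thesis
      using s(2) by (simp add: cmod_power2 e_def) (simp add: power2_eq_square algebra_simps)
  qed
  have den: "1 - \<i> * e * v \<noteq> 0" if "0 < Re v" for v
  proof
    assume "1 - \<i> * e * v = 0"
    then have "(cmod (e - \<i> * v))\<^sup>2 = - 4 * s * Re v" using norms[of v] by simp
    then show False using that s(1) mult_pos_pos[of s "Re v"] zero_le_power2[of "cmod (e - \<i> * v)"] by linarith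
  qed
  have h_disc: "cmod (h v) < 1" if "0 < Re v" for v
  proof -
    have "(cmod (e - \<i> * v))\<^sup>2 < (cmod (1 - \<i> * e * v))\<^sup>2"
      using norms[of v] mult_pos_pos[OF s(1) that] by linarith
    then have "cmod (e - \<i> * v) < cmod (1 - \<i> * e * v)"
      by (rule power_less_imp_less_base) simp
    then show ?thesis using den[OF that] by (simp add: h_def norm_divide)
  qed
  have h_deriv: "((\<lambda>w. h (exp (k * w))) has_field_derivative
      1 - 2 * c * h (exp (k * w)) + (h (exp (k * w)))\<^sup>2) (at w)" if "0 < Re (exp (k * w))" for w
  proof -
    define v where "v = exp (k * w)"
    have d: "1 - \<i> * e * v \<noteq> 0" using den that by (simp add: v_def)
    have "((\<lambda>w. h (exp (k * w))) has_field_derivative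
      ((- (\<i> * (v * k))) * (1 - \<i> * e * v) - (e - \<i> * v) * (- (\<i> * e * (v * k)))) / (1 - \<i> * e * v)\<^sup>2) (at w)"
      unfolding h_def v_def using d
      by (auto intro!: derivative_eq_intros simp: v_def power2_eq_square)
    also have "(- (\<i> * (v * k))) * (1 - \<i> * e * v) - (e - \<i> * v) * (- (\<i> * e * (v * k)))
        = \<i> * v * k * (e\<^sup>2 - 1)"
      by (simp add: power2_eq_square algebra_simps)
    also have "\<dots> = (\<i> * v * (e\<^sup>2 - 1)) * (e - cnj e)"
      by (simp add: ek)
    \<comment> \<open>Division by the squared denominator of \<open>h\<close> turns this product
      into \<open>(h v - e) * (h v - cnj e)\<close>, so \<open>h (exp (k * w))\<close> solves the
      equation \<open>u' = 1 - 2cu + u^2\<close>.\<close>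
    also have "\<dots> = ((e - \<i> * v) - e * (1 - \<i> * e * v)) * ((e - \<i> * v) - cnj e * (1 - \<i> * e * v))"
    proof -
      have "cnj e * (1 - \<i> * e * v) = cnj e - \<i> * v * (e * cnj e)" by (simp add: algebra_simps)
      then have "(e - \<i> * v) - cnj e * (1 - \<i> * e * v) = e - cnj e" using ee by simp
      moreover have "(e - \<i> * v) - e * (1 - \<i> * e * v) = \<i> * v * (e\<^sup>2 - 1)"
        by (simp add: power2_eq_square algebra_simps)
      ultimately show ?thesis by simp
    qed
    also have "\<dots> / (1 - \<i> * e * v)\<^sup>2 = (h v - e) * (h v - cnj e)"
      using d by (simp add: h_def power2_eq_square diff_divide_distrib[symmetric] field_simps)
    also have "\<dots> = 1 - (e + cnj e) * h v + (h v)\<^sup>2"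
      using ee by (simp add: power2_eq_square algebra_simps)
    finally show ?thesis by (simp add: v_def ec)
  qed
  \<comment> \<open>\<open>w \<mapsto> h (exp (k * w))\<close> maps the strip \<open>W\<close> onto the disc and is the inverse of \<open>g\<close>.\<close>
  define W where "W = {w. \<bar>Re w\<bar> < pi / (4 * s)}"
  have "W = {w. Re w < pi / (4 * s)} \<inter> {w. Re w > - (pi / (4 * s))}"
    by (auto simp: W_def)
  then have "convex W"
    by (simp add: convex_Int convex_halfspace_Re_lt convex_halfspace_Re_gt)
  have W_iff: "w \<in> W \<longleftrightarrow> \<bar>Im (k * w)\<bar> < pi / 2" for w
    using s(1) by (simp add: W_def k_def abs_mult field_simps)
  have W_exp: "0 < Re (exp (k * w))" if "w \<in> W" for w
  proof -
    have "0 < cos (Im (k * w))" using that by (intro cos_gt_zero_pi) (simp_all only: W_iff abs_less_iff, linarith+)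
    then show ?thesis by (simp only: Re_exp mult_pos_pos exp_gt_zero)
  qed
  have inj: "inj_on (\<lambda>w. p (h (exp (k * w)))) W"
  proof (rule inj_on_convex_Re_deriv_pos[OF \<open>convex W\<close>])
    fix w assume w: "w \<in> W"
    show "((\<lambda>w. p (h (exp (k * w)))) has_field_derivative
       p' (h (exp (k * w))) * (1 - 2 * c * h (exp (k * w)) + (h (exp (k * w)))\<^sup>2)) (at w)"
      by (rule DERIV_chain2[OF deriv h_deriv]) (use W_exp[OF w] h_disc in auto)
    show "0 < Re (p' (h (exp (k * w))) * (1 - 2 * c * h (exp (k * w)) + (h (exp (k * w)))\<^sup>2))"
      using pos[OF h_disc[OF W_exp[OF w]]] by (simp only: mult.commute)
  qed
  have surj: "\<exists>w\<in>W. h (exp (k * w)) = z" if z: "cmod z < 1" for z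
  proof -
    \<comment> \<open>This \<open>v\<close> solves \<open>h v = z\<close>. As
      \<open>0 < Re v\<close>, its principal logarithm has imaginary part of modulus below
      \<open>pi / 2\<close>, which puts \<open>Ln v / k\<close> in the strip.\<close>
    define v where "v = - \<i> * (e - z) / (1 - e * z)"
    have "cmod (e * z) < 1" using z ne by (simp add: norm_mult)
    then have ez: "1 - e * z \<noteq> 0" by auto
    have D: "1 - \<i> * e * v = (1 - e\<^sup>2) / (1 - e * z)"
      using ez by (simp add: v_def field_simps power2_eq_square)
    have N: "e - \<i> * v = z * (1 - \<i> * e * v)"
      unfolding D using ez by (simp add: v_def field_simps power2_eq_square)
    have D0: "1 - \<i> * e * v \<noteq> 0" using D e1 ez by simp
    have "(cmod (e - \<i> * v))\<^sup>2 < (cmod (1 - \<i> * e * v))\<^sup>2"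
      unfolding N norm_mult using z D0 by (intro power_strict_mono) auto
    then have "0 < s * Re v" using norms[of v] by linarith
    then have v: "0 < Re v" using s(1) by (simp add: zero_less_mult_iff)
    then have v0: "v \<noteq> 0" by auto
    have "k * (Ln v / k) = Ln v" using k0 by simp
    then have "Ln v / k \<in> W" "h (exp (k * (Ln v / k))) = z"
      using Re_Ln_pos_lt[OF v0] v v0 N D0 by (simp_all add: W_iff h_def)
    then show ?thesis by blast
  qed
  show ?thesis
  proof (rule inj_onI)
    fix a b assume ab: "a \<in> ball 0 1" "b \<in> ball 0 1" "p a = p b"
    obtain u where u: "u \<in> W" "h (exp (k * u)) = a" using surj[of a] ab(1) by auto
    obtain v where v: "v \<in> W" "h (exp (k * v)) = b" using surj[of b] ab(2) by auto
    have "u = v" using inj_onD[OF inj, of u v] u v ab(3) by simp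
    then show "a = b" using u v by simp
  qed
qed

text \<open>On the circle the factor \<open>Re z - c\<close> arises twice, from
  \<open>1 - 2cz + z^2\<close> and from \<open>circle\<close>, so its sign change at
  \<open>c\<close> cancels. Positivity then passes to the interior, the value at \<open>0\<close>
  being \<open>1\<close>.\<close>

lemma poly_inj_on_disc_of_circle:
  fixes p :: "complex poly" and c :: real
  assumes c: "\<bar>c\<bar> < 1" and p0: "poly (pderiv p) 0 = 1"
    and circle: "\<And>z. cmod z = 1 \<Longrightarrow> Re (z * poly (pderiv p) z) = (Re z - c) * r (Re z)"
    and r: "\<And>x. \<bar>x\<bar> \<le> 1 \<Longrightarrow> 0 \<le> r x"
  shows "inj_on (poly p) (ball 0 1)"
proof (rule inj_on_disc_of_strip_map[OF c poly_DERIV])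
  fix z :: complex assume "cmod z < 1"
  show "0 < Re ((1 - 2 * c * z + z\<^sup>2) * poly (pderiv p) z)"
  proof (rule Re_pos_of_sphere_nonneg[
        where f = "\<lambda>z. (1 - 2 * c * z + z\<^sup>2) * poly (pderiv p) z", OF _ _ _ \<open>cmod z < 1\<close>])
    fix z :: complex assume z: "cmod z = 1"
    then have "z * cnj z = 1" by (simp add: complex_norm_square[symmetric])
    then have "1 + z\<^sup>2 = z * (z + cnj z)" by (simp add: power2_eq_square algebra_simps)
    then have "1 - 2 * c * z + z\<^sup>2 = of_real (2 * (Re z - c)) * z"
      by (simp add: complex_add_cnj algebra_simps)
    then have "(1 - 2 * c * z + z\<^sup>2) * poly (pderiv p) z
        = of_real (2 * (Re z - c)) * (z * poly (pderiv p) z)"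
      by (simp only: mult.assoc)
    then have "Re ((1 - 2 * c * z + z\<^sup>2) * poly (pderiv p) z)
        = 2 * (Re z - c) * Re (z * poly (pderiv p) z)"
      by (simp only: Re_complex_of_real Im_complex_of_real times_complex.simps)
    also have "\<dots> = 2 * ((Re z - c)\<^sup>2 * r (Re z))"
      by (simp only: circle[OF z]) (simp add: power2_eq_square)
    also have "0 \<le> \<dots>"
      using r[of "Re z"] abs_Re_le_cmod[of z] z by simp
    finally show "0 \<le> Re ((1 - 2 * c * z + z\<^sup>2) * poly (pderiv p) z)" .
  qed (use p0 in \<open>auto intro!: holomorphic_intros\<close>)
qed

section \<open>Minima on the circle and extremality\<close>

lemma univalent_polys_iff:
  "p \<in> univalent_polys n \<longleftrightarrow>
     degree p = n \<and> coeff p 0 = 0 \<and> coeff p 1 = 1 \<and> inj_on (poly p) (ball 0 1)"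
  by (simp add: univalent_polys_def poly_0_coeff_0 coeff_pderiv)

lemma bdd_below_cmod: "bdd_below ((\<lambda>z. cmod (poly p z)) ` A)"
  by (rule bdd_belowI[of _ 0]) auto

lemma min_on_circle_le: "cmod z = 1 \<Longrightarrow> min_on_circle p \<le> cmod (poly p z)"
  unfolding min_on_circle_def by (rule cINF_lower[OF bdd_below_cmod]) simp

lemma min_on_circle_ge:
  assumes "\<And>z. cmod z = 1 \<Longrightarrow> m \<le> cmod (poly p z)"
  shows "m \<le> min_on_circle p"
  unfolding min_on_circle_def
proof (rule cINF_greatest)
  show "sphere (0::complex) 1 \<noteq> {}" by simp
qed (use assms in auto)

lemma min_on_circle_nonneg: "0 \<le> min_on_circle p"
  by (rule min_on_circle_ge) simp

lemma dimitrov_extremalI: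
  assumes "p \<in> univalent_polys n"
    and "\<And>q. q \<in> univalent_polys n \<Longrightarrow> min_on_circle p \<le> min_on_circle q"
  shows "dimitrov_extremal n p"
  using assms unfolding dimitrov_extremal_def by (auto intro!: cInf_eq_minimum[symmetric])

lemma not_dimitrov_extremalI:
  assumes "q \<in> univalent_polys n" "min_on_circle q < min_on_circle p"
  shows "\<not> dimitrov_extremal n p"
proof -
  have "(INF q\<in>univalent_polys n. min_on_circle q) \<le> min_on_circle q"
    using assms(1) by (intro cINF_lower bdd_belowI[of _ 0]) (auto simp: min_on_circle_nonneg)
  then show ?thesis using assms(2) by (auto simp: dimitrov_extremal_def)
qed

lemma quadratic_nonneg:
  fixes a b c t :: real
  assumes "0 < a" "b\<^sup>2 \<le> 4 * a * c"
  shows "0 \<le> a * t\<^sup>2 + b * t + c"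
proof -
  have "4 * a * (a * t\<^sup>2 + b * t + c) = (2 * a * t + b)\<^sup>2 + (4 * a * c - b\<^sup>2)"
    by (simp add: power2_eq_square algebra_simps)
  also have "\<dots> \<ge> 0" using assms(2) by simp
  finally show ?thesis using assms(1) by (simp add: zero_le_mult_iff)
qed

section \<open>Degrees one and two\<close>

lemma suffridge_poly_1: "suffridge_poly 1 = [:0, 1:]"
  by (simp add: suffridge_poly_def monom_altdef)

lemma suffridge_poly_2: "suffridge_poly 2 = [:0, 1, 1/2:]"
proof -
  have s: "sin (pi * 2 / 3) = sin (pi / 3)"
    using sin_pi_minus[of "pi / 3"] by (simp add: algebra_simps)
  have e: "{1..2} = {1, 2::nat}" by auto
  show ?thesis
    unfolding suffridge_poly_def e by (simp add: s sin_60 monom_altdef power2_eq_square)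
qed

lemma suffridge_1_extremal: "dimitrov_extremal 1 (suffridge_poly 1)"
proof (rule dimitrov_extremalI)
  show "suffridge_poly 1 \<in> univalent_polys 1"
    unfolding suffridge_poly_1 by (simp add: univalent_polys_iff inj_on_def)
next
  fix q assume q: "q \<in> univalent_polys 1"
  have "q = [:0, 1:]"
  proof (rule poly_eqI)
    fix k show "coeff q k = coeff [:0, 1:] k"
      using q coeff_eq_0[of q k]
      by (cases "k = 0"; cases "k = 1") (auto simp: univalent_polys_iff coeff_pCons split: nat.split)
  qed
  then show "min_on_circle (suffridge_poly 1) \<le> min_on_circle q"
    by (simp only: suffridge_poly_1 order_refl)
qed

text \<open>A quadratic coefficient larger than \<open>1/2\<close> in modulus would put the critical
  point inside the disc, where injectivity fails.\<close>

lemma univalent_polys_2_cases: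
  assumes "q \<in> univalent_polys 2"
  shows "\<exists>a. cmod a \<le> 1/2 \<and> q = [:0, 1, a:]"
proof (intro exI conjI)
  define a where "a = coeff q 2"
  show q: "q = [:0, 1, coeff q 2:]"
  proof (rule poly_eqI)
    fix k show "coeff q k = coeff [:0, 1, coeff q 2:] k"
      using assms coeff_eq_0[of q k]
      by (cases "k = 0"; cases "k = 1"; cases "k = 2")
        (auto simp: univalent_polys_iff coeff_pCons numeral_2_eq_2 split: nat.split)
  qed
  have qa: "poly q z = z + a * z\<^sup>2" for z
  proof -
    have "poly q z = poly [:0, 1, a:] z"
      by (rule arg_cong[OF q[folded a_def]])
    then show ?thesis by (simp add: power2_eq_square algebra_simps)
  qed
  show "cmod (coeff q 2) \<le> 1/2"
  proof (rule ccontr)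
    assume "\<not> cmod (coeff q 2) \<le> 1/2"
    then have a: "1 < 2 * cmod a" by (simp add: a_def)
    then have a0: "a \<noteq> 0" by auto
    define z where "z = - 1 / (2 * a)"
    \<comment> \<open>\<open>z\<close> is the critical point, about which \<open>q\<close> is even.\<close>
    define d where "d = complex_of_real ((1 - cmod z) / 2)"
    have z1: "cmod z < 1" using a a0 by (simp add: z_def norm_divide norm_mult divide_less_eq)
    then have nd: "cmod d = (1 - cmod z) / 2" by (simp only: d_def norm_of_real) simp
    have "poly q (z + d) = poly q (z - d)"
      using a0 by (simp add: qa z_def field_simps power2_eq_square)
    moreover have "cmod z + cmod d < 1" unfolding nd using z1 by (simp add: field_simps)
    then have "cmod (z + d) < 1" "cmod (z - d) < 1"
      by (blast intro: le_less_trans norm_triangle_ineq norm_triangle_ineq4)+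
    ultimately have "z + d = z - d"
      using assms by (auto simp: univalent_polys_iff inj_on_def)
    then have "d = 0" by simp
    then show False using nd z1 by simp
  qed
qed

lemma suffridge_2_extremal: "dimitrov_extremal 2 (suffridge_poly 2)"
proof (rule dimitrov_extremalI)
  have "inj_on (poly [:0, 1, 1/2:]) (ball (0::complex) 1)"
  proof (rule inj_onI)
    fix z w :: complex assume zw: "z \<in> ball 0 1" "w \<in> ball 0 1"
      "poly [:0, 1, 1/2:] z = poly [:0, 1, 1/2:] w"
    \<comment> \<open>The difference of the two values is a multiple of this product, whose second
      factor can vanish only if \<open>z + w = -2\<close>.\<close>
    have "2 * ((z - w) * (2 + (z + w))) = 0"
      using zw(3) by (simp add: field_simps)
    moreover have "cmod (z + w) < 2" using zw(1,2) norm_triangle_ineq[of z w] by simp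
    then have "2 + (z + w) \<noteq> 0"
      by (metis add_eq_0_iff2 less_irrefl norm_minus_cancel norm_numeral add.commute)
    ultimately show "z = w" by simp
  qed
  then show "suffridge_poly 2 \<in> univalent_polys 2"
    unfolding suffridge_poly_2 by (simp add: univalent_polys_iff)
next
  fix q assume "q \<in> univalent_polys 2"
  then obtain a where a: "cmod a \<le> 1/2" "q = [:0, 1, a:]"
    using univalent_polys_2_cases by blast
  have "min_on_circle (suffridge_poly 2) \<le> 1/2"
    using min_on_circle_le[of "-1" "suffridge_poly 2"] by (simp add: suffridge_poly_2)
  also have "1/2 \<le> min_on_circle q"
  proof (rule min_on_circle_ge)
    fix z :: complex assume z: "cmod z = 1"
    have "cmod (poly q z) = cmod (1 + z * a)" using z by (simp add: a(2) norm_mult)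
    also have "\<dots> \<ge> 1 - cmod (z * a)" using norm_diff_ineq[of 1 "z * a"] by simp
    finally show "1/2 \<le> cmod (poly q z)" using a(1) z by (simp add: norm_mult)
  qed
  finally show "min_on_circle (suffridge_poly 2) \<le> min_on_circle q" .
qed

section \<open>Suffridge coefficients\<close>

text \<open>For \<open>n \<ge> 1\<close> this is the Chebyshev polynomial of the second kind
  \<open>U_(k-1)\<close> at \<open>cos (pi / (n + 1))\<close>, with
  \<open>U_(-1) = 0\<close>.\<close>

definition sin_ratio :: "nat \<Rightarrow> nat \<Rightarrow> real" where
  "sin_ratio n k = sin (pi * real k / (real n + 1)) / sin (pi / (real n + 1))"

lemma sin_pi_Suc_pos: "1 \<le> n \<Longrightarrow> 0 < sin (pi / (real n + 1))"
  by (intro sin_gt_zero) (auto simp: field_simps)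

lemma sin_ratio_1: "1 \<le> n \<Longrightarrow> sin_ratio n 1 = 1"
  using sin_pi_Suc_pos[of n] by (simp add: sin_ratio_def)

text \<open>Together with the Chebyshev recurrence this symmetry yields, in degrees 3 to 6, a
  polynomial equation for \<open>sin_ratio n 2\<close>, which replaces trigonometric
  evaluation.\<close>

lemma sin_ratio_sym:
  assumes "k \<le> n + 1"
  shows "sin_ratio n (n + 1 - k) = sin_ratio n k"
proof -
  have "pi * real (n + 1 - k) / (real n + 1) = pi - pi * real k / (real n + 1)"
    using assms by (simp add: of_nat_diff field_simps)
  then show ?thesis by (simp add: sin_ratio_def)
qed

lemma sin_ratio_Suc_Suc:
  "sin_ratio n (Suc (Suc k)) = 2 * cos (pi / (real n + 1)) * sin_ratio n (Suc k) - sin_ratio n k"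
proof -
  define \<theta> where "\<theta> = pi / (real n + 1)"
  have e: "pi * real j / (real n + 1) = real j * \<theta>" for j by (simp add: \<theta>_def)
  have "sin (real (Suc (Suc k)) * \<theta>) + sin (real k * \<theta>) = 2 * cos \<theta> * sin (real (Suc k) * \<theta>)"
    using sin_add[of "real (Suc k) * \<theta>" \<theta>] sin_diff[of "real (Suc k) * \<theta>" \<theta>]
    by (simp add: algebra_simps)
  then have "sin (real (Suc (Suc k)) * \<theta>) = 2 * cos \<theta> * sin (real (Suc k) * \<theta>) - sin (real k * \<theta>)"
    by simp
  then show ?thesis unfolding sin_ratio_def e \<theta>_def[symmetric]
    by (simp add: diff_divide_distrib)
qed

lemma sin_ratio_2: "1 \<le> n \<Longrightarrow> sin_ratio n 2 = 2 * cos (pi / (real n + 1))"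
  using sin_ratio_Suc_Suc[of n 0] sin_ratio_1[of n]
  by (simp add: sin_ratio_def numeral_2_eq_2)

lemma sin_ratio_3: "1 \<le> n \<Longrightarrow> sin_ratio n 3 = (sin_ratio n 2)\<^sup>2 - 1"
  using sin_ratio_Suc_Suc[of n 1] sin_ratio_1[of n] sin_ratio_2[of n]
  by (simp add: numeral_2_eq_2 numeral_3_eq_3 power2_eq_square)

lemma sin_ratio_4: "1 \<le> n \<Longrightarrow> sin_ratio n 4 = (sin_ratio n 2) ^ 3 - 2 * sin_ratio n 2"
  using sin_ratio_Suc_Suc[of n 2] sin_ratio_2[of n]
  by (simp add: sin_ratio_3[unfolded numeral_3_eq_3] eval_nat_numeral algebra_simps)

text \<open>Selects the relevant root of the polynomial equation for
  \<open>sin_ratio n 2\<close>.\<close>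

lemma sin_ratio_2_gt_1:
  assumes "3 \<le> n"
  shows "1 < sin_ratio n 2"
proof -
  have "pi / (real n + 1) < pi / 3"
    using assms by (intro divide_strict_left_mono) auto
  then have "cos (pi / 3) < cos (pi / (real n + 1))"
    by (intro cos_monotone_0_pi) auto
  then show ?thesis using assms by (simp add: sin_ratio_2 cos_60)
qed

lemma poly_suffridge:
  "poly (suffridge_poly n) z = (\<Sum>k=1..n. of_real ((1 - (real k - 1) / n) * sin_ratio n k) * z ^ k)"
  by (simp only: suffridge_poly_def sin_ratio_def poly_sum poly_monom)

text \<open>Lets rational coefficients \<open>c\<close> replace the irrational ones: on the circle
  the two polynomials differ by at most the sum of the coefficient errors.\<close>

lemma suffridge_perturb:
  fixes c :: "nat \<Rightarrow> real"
  assumes "\<And>z. cmod z = 1 \<Longrightarrow> m + \<epsilon> \<le> cmod (\<Sum>k=1..n. of_real (c k) * z ^ k)"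
    and "(\<Sum>k=1..n. \<bar>(1 - (real k - 1) / n) * sin_ratio n k - c k\<bar>) \<le> \<epsilon>"
  shows "m \<le> min_on_circle (suffridge_poly n)"
proof (rule min_on_circle_ge)
  fix z :: complex assume z: "cmod z = 1"
  define P where "P = (\<Sum>k=1..n. of_real (c k) * z ^ k)"
  have "poly (suffridge_poly n) z - P
      = (\<Sum>k=1..n. of_real ((1 - (real k - 1) / n) * sin_ratio n k - c k) * z ^ k)"
    by (simp add: poly_suffridge P_def sum_subtractf[symmetric] algebra_simps)
  also have "cmod \<dots> \<le> (\<Sum>k=1..n. \<bar>(1 - (real k - 1) / n) * sin_ratio n k - c k\<bar>)"
    by (rule order.trans[OF norm_sum]) (simp only: norm_mult norm_power z norm_of_real power_one mult_1_right order_refl)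
  finally have "cmod (poly (suffridge_poly n) z - P) \<le> \<epsilon>" using assms(2) by simp
  moreover have "m + \<epsilon> \<le> cmod P" using assms(1)[OF z] by (simp add: P_def)
  ultimately show "m \<le> cmod (poly (suffridge_poly n) z)"
    using norm_triangle_ineq2[of P "poly (suffridge_poly n) z"] by (simp add: norm_minus_commute)
qed

section \<open>Polynomials on the unit circle\<close>

text \<open>Reduction modulo \<open>z^2 = 2xz - 1\<close>, \<open>x = Re z\<close>, which is
  \<open>z + cnj z = 2x\<close> multiplied by \<open>z\<close>. The coefficients are
  \<open>U_(k-1)(x)\<close> and \<open>- U_(k-2)(x)\<close>.\<close>

lemma circle_powers:
  assumes "cmod z = 1"
  shows "z ^ 2 = of_real (2 * Re z) * z + of_real (-1)"
    "z ^ 3 = of_real (4 * (Re z)^2 - 1) * z + of_real (- 2 * Re z)"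
    "z ^ 4 = of_real (8 * (Re z)^3 - 4 * Re z) * z + of_real (1 - 4 * (Re z)^2)"
    "z ^ 5 = of_real (16 * (Re z)^4 - 12 * (Re z)^2 + 1) * z + of_real (4 * Re z - 8 * (Re z)^3)"
    "z ^ 6 = of_real (32 * (Re z)^5 - 32 * (Re z)^3 + 6 * Re z) * z
       + of_real (12 * (Re z)^2 - 1 - 16 * (Re z)^4)"
proof -
  define x where "x = complex_of_real (Re z)"
  have "z * cnj z = 1" using assms by (simp add: complex_norm_square[symmetric])
  moreover have "z + cnj z = 2 * x" by (simp add: x_def complex_add_cnj)
  ultimately have z2: "z * z = 2 * x * z - 1"
    by (metis add_diff_cancel_right' distrib_left mult.commute)
  have step: "z * (a * z + b) = (2 * x * a + b) * z - a" for a b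
  proof -
    have "z * (a * z + b) = a * (z * z) + b * z" by (simp add: algebra_simps)
    then show ?thesis unfolding z2 by (simp add: algebra_simps)
  qed
  have 2: "z ^ 2 = 2 * x * z + (-1)" using z2 by (simp add: power2_eq_square)
  have 3: "z ^ 3 = (4 * x^2 - 1) * z + (- 2 * x)"
    using step[of "2 * x" "-1"] unfolding 2[symmetric]
    by (simp add: eval_nat_numeral algebra_simps)
  have 4: "z ^ 4 = (8 * x^3 - 4 * x) * z + (1 - 4 * x^2)"
    using step[of "4 * x^2 - 1" "- 2 * x"] unfolding 3[symmetric]
    by (simp add: eval_nat_numeral algebra_simps)
  have 5: "z ^ 5 = (16 * x^4 - 12 * x^2 + 1) * z + (4 * x - 8 * x^3)"
    using step[of "8 * x^3 - 4 * x" "1 - 4 * x^2"] unfolding 4[symmetric]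
    by (simp add: eval_nat_numeral algebra_simps)
  have 6: "z ^ 6 = (32 * x^5 - 32 * x^3 + 6 * x) * z + (12 * x^2 - 1 - 16 * x^4)"
    using step[of "16 * x^4 - 12 * x^2 + 1" "4 * x - 8 * x^3"] unfolding 5[symmetric]
    by (simp add: eval_nat_numeral algebra_simps)
  show "z ^ 2 = of_real (2 * Re z) * z + of_real (-1)"
    "z ^ 3 = of_real (4 * (Re z)^2 - 1) * z + of_real (- 2 * Re z)"
    "z ^ 4 = of_real (8 * (Re z)^3 - 4 * Re z) * z + of_real (1 - 4 * (Re z)^2)"
    "z ^ 5 = of_real (16 * (Re z)^4 - 12 * (Re z)^2 + 1) * z + of_real (4 * Re z - 8 * (Re z)^3)"
    "z ^ 6 = of_real (32 * (Re z)^5 - 32 * (Re z)^3 + 6 * Re z) * z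
       + of_real (12 * (Re z)^2 - 1 - 16 * (Re z)^4)"
    using 2 3 4 5 6 by (simp_all add: x_def)
qed

lemma cmod_linear_circle:
  assumes "cmod z = 1"
  shows "(cmod (of_real a * z + of_real b))\<^sup>2 = a\<^sup>2 + 2 * a * b * Re z + b\<^sup>2"
proof -
  have "(a * Re z + b)\<^sup>2 + (a * Im z)\<^sup>2 = a\<^sup>2 * ((Re z)\<^sup>2 + (Im z)\<^sup>2) + 2 * a * b * Re z + b\<^sup>2"
    by (simp add: power2_eq_square algebra_simps)
  moreover have "(Re z)\<^sup>2 + (Im z)\<^sup>2 = 1" using assms cmod_power2[of z] by simp
  ultimately show ?thesis by (simp add: cmod_power2)
qed

text \<open>The right-hand sides are the Chebyshev polynomials of the first kind
  \<open>T_k\<close>.\<close>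

lemma Re_circle_powers:
  assumes "cmod z = 1"
  shows "Re (z ^ 2) = 2 * (Re z)^2 - 1"
    "Re (z ^ 3) = 4 * (Re z)^3 - 3 * Re z"
    "Re (z ^ 4) = 8 * (Re z)^4 - 8 * (Re z)^2 + 1"
    "Re (z ^ 5) = 16 * (Re z)^5 - 20 * (Re z)^3 + 5 * Re z"
    "Re (z ^ 6) = 32 * (Re z)^6 - 48 * (Re z)^4 + 18 * (Re z)^2 - 1"
  unfolding circle_powers[OF assms]
  by (simp_all only: plus_complex.simps times_complex.simps Re_complex_of_real Im_complex_of_real)
    (simp_all add: eval_nat_numeral algebra_simps)

text \<open>Removing one factor \<open>z\<close> keeps the modulus; the remaining powers reduce to
  \<open>A z + B\<close> with real \<open>A\<close>, \<open>B\<close>. The squared modulus thus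
  becomes a real polynomial in \<open>Re z\<close> alone.\<close>

lemma cmod_circle_poly:
  assumes "cmod z = 1"
    and A: "A = c2 + c3 * (2 * Re z) + c4 * (4 * (Re z)^2 - 1) + c5 * (8 * (Re z)^3 - 4 * Re z)
      + c6 * (16 * (Re z)^4 - 12 * (Re z)^2 + 1)"
    and B: "B = c1 - c3 - c4 * (2 * Re z) + c5 * (1 - 4 * (Re z)^2) + c6 * (4 * Re z - 8 * (Re z)^3)"
  shows "(cmod (of_real c1 * z + of_real c2 * z^2 + of_real c3 * z^3 + of_real c4 * z^4
      + of_real c5 * z^5 + of_real c6 * z^6))\<^sup>2 = A\<^sup>2 + 2 * A * B * Re z + B\<^sup>2"
proof -
  have "of_real c1 * z + of_real c2 * z^2 + of_real c3 * z^3 + of_real c4 * z^4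
      + of_real c5 * z^5 + of_real c6 * z^6
    = z * (of_real c1 + of_real c2 * z + of_real c3 * z^2 + of_real c4 * z^3
      + of_real c5 * z^4 + of_real c6 * z^5)"
    by (simp add: eval_nat_numeral algebra_simps)
  also have "of_real c1 + of_real c2 * z + of_real c3 * z^2 + of_real c4 * z^3
      + of_real c5 * z^4 + of_real c6 * z^5 = of_real A * z + of_real B"
    unfolding circle_powers[OF assms(1)] A B by (simp add: algebra_simps)
  finally show ?thesis
    by (simp only: norm_mult assms(1) mult_1_left cmod_linear_circle[OF assms(1)])
qed

lemma sum_1_to:
  fixes f :: "nat \<Rightarrow> 'a::comm_monoid_add"
  shows "(\<Sum>k=1..3. f k) = f 1 + f 2 + f 3"
    "(\<Sum>k=1..4. f k) = f 1 + f 2 + f 3 + f 4"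
    "(\<Sum>k=1..5. f k) = f 1 + f 2 + f 3 + f 4 + f 5"
    "(\<Sum>k=1..6. f k) = f 1 + f 2 + f 3 + f 4 + f 5 + f 6"
  by (simp_all add: eval_nat_numeral add.assoc)

section \<open>Univalent competitors\<close>

text \<open>A collision of values at \<open>z \<noteq> w\<close> forces
  \<open>d^2 = - (1 + 3 s^2)\<close> for \<open>d = z - w\<close>, \<open>s = z + w + 2\<close>; the
  parallelogram law excludes this in the open disc.\<close>

lemma competitor_3_univalent: "[:0, 1, 12/13, 4/13:] \<in> univalent_polys 3"
proof -
  \<comment> \<open>The polynomial is \<open>|1 + 3 s^2|^2 - (4X - X^2 - Y)^2\<close> with
    \<open>X = Re s\<close>, \<open>Y = (Im s)^2\<close>. It vanishes at \<open>X = 1/2\<close>,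
    \<open>Y = 0\<close>, a collision of two conjugate points of the unit circle.\<close>
  have key: "0 \<le> (2*X - 1)\<^sup>2 * (1 + 4*X + 2*X\<^sup>2) + Y * (16*X\<^sup>2 + 8*X - 6) + 8*Y\<^sup>2"
    if Y: "0 \<le> Y" "Y \<le> 4*X - X\<^sup>2" for X Y :: real
  proof -
    have X: "0 \<le> X" using Y zero_le_power2[of X] by linarith
    \<comment> \<open>As a quadratic in \<open>Y\<close>, the expression has nonpositive
      discriminant for middle \<open>X\<close> and nonnegative coefficients for large
      \<open>X\<close>. For small \<open>X\<close> the upper bound on \<open>Y\<close> is
      needed.\<close>
    consider "X \<le> 1/12" | "1/12 \<le> X" "X \<le> 9/20" | "9/20 \<le> X" by linarith
    then show ?thesis
    proof cases
      case 1
      define Q where "Q = 4*X - X\<^sup>2"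
      have "(2*X - 1)\<^sup>2 * (1 + 4*X + 2*X\<^sup>2) + Y * (16*X\<^sup>2 + 8*X - 6) + 8*Y\<^sup>2
         = (1 + 3*X\<^sup>2 - 3*Q)\<^sup>2 + 36*X\<^sup>2*Q + (Q - Y) * ((6 - 72*X) + 8 * (Q - Y))"
        by (simp add: Q_def power2_eq_square algebra_simps)
      also have "\<dots> \<ge> 0"
        using Y 1 by (intro add_nonneg_nonneg mult_nonneg_nonneg zero_le_power2) (auto simp: Q_def)
      finally show ?thesis .
    next
      case 2
      have "0 \<le> (X - 1/12) * (9/20 - X)" using 2 by simp
      then have "X * X \<le> 8/15 * X - 3/80" by (simp add: field_simps)
      moreover have "4 * 8 * ((2*X - 1)\<^sup>2 * (1 + 4*X + 2*X\<^sup>2)) - (16*X\<^sup>2 + 8*X - 6)\<^sup>2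
          = 96 * X - 192 * (X * X) - 4"
        by (simp add: power2_eq_square algebra_simps)
      ultimately have "(16*X\<^sup>2 + 8*X - 6)\<^sup>2 \<le> 4 * 8 * ((2*X - 1)\<^sup>2 * (1 + 4*X + 2*X\<^sup>2))"
        using 2 by linarith
      from quadratic_nonneg[OF _ this, of Y] show ?thesis by (simp add: algebra_simps)
    next
      case 3
      have "X * X \<ge> 9/20 * (9/20)" using 3 by (intro mult_mono) auto
      then have "0 \<le> 16*X\<^sup>2 + 8*X - 6" using 3 by (simp add: power2_eq_square)
      then show ?thesis using Y X
        by (intro add_nonneg_nonneg mult_nonneg_nonneg) auto
    qed
  qed
  have "inj_on (poly [:0, 1, 12/13, 4/13:]) (ball (0::complex) 1)"
  proof (rule inj_onI, rule ccontr)
    fix z w :: complex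
    assume zw: "z \<in> ball 0 1" "w \<in> ball 0 1" "z \<noteq> w"
      "poly [:0, 1, 12/13, 4/13:] z = poly [:0, 1, 12/13, 4/13:] w"
    \<comment> \<open>The shift by \<open>2\<close> removes the linear term of the collision
      equation.\<close>
    define s d where "s = z + w + 2" and "d = z - w"
    have "(z - w) * (13 + 12*(z+w) + 4 * (z*z + z*w + w*w))
        = 13 * (poly [:0, 1, 12/13, 4/13:] z - poly [:0, 1, 12/13, 4/13:] w)"
      by (simp add: field_simps)
    also have "\<dots> = 0" using zw(4) by simp
    finally have "(z - w) * (13 + 12*(z+w) + 4 * (z*z + z*w + w*w)) = 0" .
    then have "13 + 12*(z+w) + 4 * (z*z + z*w + w*w) = 0" using zw(3) by simp
    then have d2: "d\<^sup>2 = - (1 + 3 * s\<^sup>2)"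
      by (simp add: s_def d_def power2_eq_square algebra_simps add_eq_0_iff)
    define X Y where "X = Re s" and "Y = (Im s)\<^sup>2"
    have "(cmod (d\<^sup>2))\<^sup>2 = (1 + 3*X\<^sup>2 - 3*Y)\<^sup>2 + 36*X\<^sup>2*Y"
      unfolding d2 norm_minus_cancel cmod_power2 X_def Y_def
      by (simp add: power2_eq_square algebra_simps)
    \<comment> \<open>Parallelogram law: \<open>\<bar>z + w\<bar>\<^sup>2 + \<bar>z - w\<bar>\<^sup>2 < 4\<close>.\<close>
    moreover have "cmod (d\<^sup>2) < 4*X - X\<^sup>2 - Y"
    proof -
      have "(cmod z)\<^sup>2 < 1" "(cmod w)\<^sup>2 < 1" using zw(1,2) by (simp_all add: power_less_one_iff)
      moreover have "(cmod d)\<^sup>2 + (4 - (4*X - X\<^sup>2 - Y)) = 2 * (cmod z)\<^sup>2 + 2 * (cmod w)\<^sup>2"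
        unfolding cmod_power2 X_def Y_def s_def d_def
        by (simp add: power2_eq_square algebra_simps)
      ultimately show ?thesis unfolding norm_power by linarith
    qed
    moreover from this have "0 \<le> 4*X - X\<^sup>2 - Y"
      by (meson norm_ge_zero order.strict_iff_order order.trans)
    ultimately have "(1 + 3*X\<^sup>2 - 3*Y)\<^sup>2 + 36*X\<^sup>2*Y < (4*X - X\<^sup>2 - Y)\<^sup>2"
      by (metis norm_ge_zero pos2 power_strict_mono)
    moreover have "0 \<le> Y" by (simp add: Y_def)
    moreover have "(1 + 3*X\<^sup>2 - 3*Y)\<^sup>2 + 36*X\<^sup>2*Y - (4*X - X\<^sup>2 - Y)\<^sup>2
       = (2*X - 1)\<^sup>2 * (1 + 4*X + 2*X\<^sup>2) + Y * (16*X\<^sup>2 + 8*X - 6) + 8*Y\<^sup>2"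
      by (simp add: power2_eq_square algebra_simps)
    ultimately show False using key[of Y X] \<open>0 \<le> 4*X - X\<^sup>2 - Y\<close> by linarith
  qed
  then show ?thesis by (simp add: univalent_polys_iff)
qed

text \<open>The coefficients come from expanding \<open>(x - c) r(x)\<close> in the
  \<open>T_k\<close> and dividing the \<open>k\<close>-th one by \<open>k\<close>; the leading
  constant of \<open>r\<close> normalizes the \<open>T_1\<close> coefficient to \<open>1\<close>.
  Degrees 5 and 6 follow the same scheme.\<close>

lemma competitor_4_univalent: "[:0, 1, 521/474, 400/711, 29/237:] \<in> univalent_polys 4"
proof -
  let ?p = "[:0, 1, 521/474, 400/711, 29/237:] :: complex poly"
  have "inj_on (poly ?p) (ball 0 1)"
  proof (rule poly_inj_on_disc_of_circle[where c = "45/58" and r = "\<lambda>x. 928/237 * ((1 + x) * (x + 3/4)\<^sup>2)"])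
    fix z :: complex assume z: "cmod z = 1"
    have "z * poly (pderiv ?p) z = z + of_real (521/237) * z^2 + of_real (400/237) * z^3
        + of_real (116/237) * z^4"
      by (simp add: pderiv_pCons eval_nat_numeral algebra_simps)
    then have "Re (z * poly (pderiv ?p) z) = Re z + 521/237 * Re (z^2) + 400/237 * Re (z^3)
        + 116/237 * Re (z^4)"
      by (simp only: plus_complex.simps times_complex.simps Re_complex_of_real Im_complex_of_real)
    also have "\<dots> = (Re z - 45/58) * (928/237 * ((1 + Re z) * (Re z + 3/4)\<^sup>2))"
      unfolding Re_circle_powers[OF z] by (simp add: eval_nat_numeral field_simps)
    finally show "Re (z * poly (pderiv ?p) z) = (Re z - 45/58) * (928/237 * ((1 + Re z) * (Re z + 3/4)\<^sup>2))" .
  qed (simp_all add: pderiv_pCons abs_le_iff)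
  then show ?thesis by (simp add: univalent_polys_iff)
qed

lemma competitor_5_univalent: "[:0, 1, 23/18, 8/9, 13/36, 1/15:] \<in> univalent_polys 5"
proof -
  let ?p = "[:0, 1, 23/18, 8/9, 13/36, 1/15:] :: complex poly"
  have "inj_on (poly ?p) (ball 0 1)"
  proof (rule poly_inj_on_disc_of_circle[where c = "5/6" and r = "\<lambda>x. 16/3 * ((x + 1)\<^sup>2 * (x + 1/2)\<^sup>2)"])
    fix z :: complex assume z: "cmod z = 1"
    have "z * poly (pderiv ?p) z = z + of_real (23/9) * z^2 + of_real (8/3) * z^3
        + of_real (13/9) * z^4 + of_real (1/3) * z^5"
      by (simp add: pderiv_pCons eval_nat_numeral algebra_simps)
    then have "Re (z * poly (pderiv ?p) z) = Re z + 23/9 * Re (z^2) + 8/3 * Re (z^3)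
        + 13/9 * Re (z^4) + 1/3 * Re (z^5)"
      by (simp only: plus_complex.simps times_complex.simps Re_complex_of_real Im_complex_of_real)
    also have "\<dots> = (Re z - 5/6) * (16/3 * ((Re z + 1)\<^sup>2 * (Re z + 1/2)\<^sup>2))"
      unfolding Re_circle_powers[OF z] by (simp add: eval_nat_numeral field_simps)
    finally show "Re (z * poly (pderiv ?p) z) = (Re z - 5/6) * (16/3 * ((Re z + 1)\<^sup>2 * (Re z + 1/2)\<^sup>2))" .
  qed (simp_all add: pderiv_pCons abs_le_iff)
  then show ?thesis by (simp add: univalent_polys_iff)
qed

lemma competitor_6_univalent: "[:0, 1, 764/563, 586/563, 571/1126, 83/563, 11/563:] \<in> univalent_polys 6"
proof -
  let ?p = "[:0, 1, 764/563, 586/563, 571/1126, 83/563, 11/563:] :: complex poly"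
  have "inj_on (poly ?p) (ball 0 1)"
  proof (rule poly_inj_on_disc_of_circle[where c = "113/132" and r = "\<lambda>x. 2112/563 * ((1 + x)^3 * (x + 1/2)\<^sup>2)"])
    fix z :: complex assume z: "cmod z = 1"
    have "z * poly (pderiv ?p) z = z + of_real (1528/563) * z^2 + of_real (1758/563) * z^3
        + of_real (1142/563) * z^4 + of_real (415/563) * z^5 + of_real (66/563) * z^6"
      by (simp add: pderiv_pCons eval_nat_numeral algebra_simps)
    then have "Re (z * poly (pderiv ?p) z) = Re z + 1528/563 * Re (z^2) + 1758/563 * Re (z^3)
        + 1142/563 * Re (z^4) + 415/563 * Re (z^5) + 66/563 * Re (z^6)"
      by (simp only: plus_complex.simps times_complex.simps Re_complex_of_real Im_complex_of_real)
    also have "\<dots> = (Re z - 113/132) * (2112/563 * ((1 + Re z)^3 * (Re z + 1/2)\<^sup>2))"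
      unfolding Re_circle_powers[OF z] by (simp add: eval_nat_numeral field_simps)
    finally show "Re (z * poly (pderiv ?p) z) = (Re z - 113/132) * (2112/563 * ((1 + Re z)^3 * (Re z + 1/2)\<^sup>2))" .
  qed (simp_all add: pderiv_pCons abs_le_iff)
  then show ?thesis by (simp add: univalent_polys_iff)
qed

section \<open>Lower bounds for the Suffridge polynomials\<close>

lemma min_on_circle_suffridge_3_ge: "0.3848 \<le> min_on_circle (suffridge_poly 3)"
proof (rule min_on_circle_ge)
  fix z :: complex assume z: "cmod z = 1"
  define y x where "y = sin_ratio 3 2" and "x = Re z"
  have r: "sin_ratio 3 1 = 1" "sin_ratio 3 3 = 1"
    using sin_ratio_1[of 3] sin_ratio_sym[of 1 3] by simp_all
  then have y2: "y\<^sup>2 = 2" using sin_ratio_3[of 3] by (simp add: y_def)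
  have "poly (suffridge_poly 3) z = of_real 1 * z + of_real (2/3 * y) * z^2 + of_real (1/3) * z^3"
    unfolding poly_suffridge sum_1_to r y_def by simp
  then have "(cmod (poly (suffridge_poly 3) z))\<^sup>2
      = (2/3 * y + 1/3 * (2 * x))\<^sup>2 + 2 * (2/3 * y + 1/3 * (2 * x)) * (1 - 1/3) * x + (1 - 1/3)\<^sup>2"
    using cmod_circle_poly[OF z refl refl, of 1 "2/3 * y" "1/3" 0 0 0] by (simp add: x_def)
  \<comment> \<open>Completing the square in \<open>x\<close> leaves \<open>4/27\<close>, whose root
    is about 0.3849.\<close>
  also have "\<dots> = 4/3 * (x + 2/3 * y)\<^sup>2 + 4/27 + 4/27 * (2 - y\<^sup>2)"
    by (simp add: power2_eq_square field_simps)
  also have "\<dots> = 4/3 * (x + 2/3 * y)\<^sup>2 + 4/27" using y2 by simp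
  also have "\<dots> \<ge> 0.3848\<^sup>2"
  proof -
    have "(0.3848::real)\<^sup>2 \<le> 4/27" by (simp add: power2_eq_square)
    also have "\<dots> \<le> 4/3 * (x + 2/3 * y)\<^sup>2 + 4/27" by simp
    finally show ?thesis .
  qed
  finally show "0.3848 \<le> cmod (poly (suffridge_poly 3) z)" by (rule power2_le_imp_le) simp
qed

lemma min_on_circle_suffridge_4_ge: "0.3428 \<le> min_on_circle (suffridge_poly 4)"
proof -
  define y where "y = sin_ratio 4 2"
  have r: "sin_ratio 4 1 = 1" "sin_ratio 4 3 = y" "sin_ratio 4 4 = 1"
    using sin_ratio_1[of 4] sin_ratio_sym[of 1 4] sin_ratio_sym[of 2 4] by (simp_all add: y_def)
  have y2: "y\<^sup>2 = y + 1" using sin_ratio_3[of 4] r by (simp add: y_def)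
  have y1: "1 < y" using sin_ratio_2_gt_1[of 4] by (simp add: y_def)
  \<comment> \<open>As \<open>1.618 - 0.618 = 1\<close>, the equation \<open>y^2 = y + 1\<close>
    makes the product the constant \<open>1 - 1.618 * 0.618\<close>.\<close>
  have "0 < (y - 1.618) * (y + 0.618)" using y2 by (simp add: power2_eq_square algebra_simps)
  then have lo: "1.618 \<le> y" using y1 by (simp add: zero_less_mult_iff)
  have "0 < (1.6181 - y) * (y + 0.6181)" using y2 by (simp add: power2_eq_square algebra_simps)
  then have hi: "y \<le> 1.6181" using y1 by (simp add: zero_less_mult_iff)
  show ?thesis
  \<comment> \<open>The entries round the Suffridge coefficients; the leading \<open>0\<close>
    aligns list positions with exponents.\<close>
  proof (rule suffridge_perturb[where c = "(!) [0, 1, 1.2135, 0.809, 0.25]" and \<epsilon> = "0.0002"])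
    show "(\<Sum>k=1..4. \<bar>(1 - (real k - 1) / real 4) * sin_ratio 4 k - [0, 1, 1.2135, 0.809, 0.25] ! k\<bar>) \<le> 0.0002"
      unfolding sum_1_to r y_def[symmetric] using lo hi by (simp add: abs_if)
  next
    fix z :: complex assume z: "cmod z = 1"
    define x where "x = Re z"
    define t where "t = x + 1"
    have t: "0 \<le> t" using z abs_Re_le_cmod[of z] by (simp add: t_def x_def abs_le_iff)
    let ?S = "\<Sum>k=1..4. of_real ([0, 1, 1.2135, 0.809, 0.25] ! k) * z ^ k"
    define A where "A = 1.2135 + 0.809 * (2 * x) + 0.25 * (4 * x\<^sup>2 - 1)"
    define B where "B = 1 - 0.809 - 0.25 * (2 * x)"
    have "?S = of_real 1 * z + of_real 1.2135 * z^2 + of_real 0.809 * z^3 + of_real 0.25 * z^4"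
      unfolding sum_1_to by simp
    then have "(cmod ?S)\<^sup>2 = A\<^sup>2 + 2 * A * B * x + B\<^sup>2"
      using cmod_circle_poly[OF z refl refl, of 1 "1.2135" "0.809" "0.25" 0 0]
      by (simp add: x_def A_def B_def)
    \<comment> \<open>Expansion about \<open>z = -1\<close>, where \<open>t = 0\<close>: the
      constant part is the squared modulus there, and the rest is \<open>t \<ge> 0\<close> times a
      nonnegative quadratic.\<close>
    also have "\<dots> = 0.343\<^sup>2 + 1377/800000 + t * (2 * t\<^sup>2 + (- 3101/2000) * t + 395943/1000000)"
      unfolding A_def B_def t_def by (simp add: eval_nat_numeral field_simps)
    also have "\<dots> \<ge> 0.343\<^sup>2"
      using mult_nonneg_nonneg[OF t quadratic_nonneg[of 2 "- 3101/2000" "395943/1000000" t]]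
      by (simp add: power2_eq_square)
    finally show "0.3428 + 0.0002 \<le> cmod ?S"
      using power2_le_imp_le[of "0.343" "cmod ?S"] by simp
  qed
qed

lemma min_on_circle_suffridge_5_ge: "0.3178 \<le> min_on_circle (suffridge_poly 5)"
proof -
  define y where "y = sin_ratio 5 2"
  have r': "sin_ratio 5 1 = 1" "sin_ratio 5 4 = y" "sin_ratio 5 5 = 1"
    using sin_ratio_1[of 5] sin_ratio_sym[of 1 5] sin_ratio_sym[of 2 5] by (simp_all add: y_def)
  have y1: "1 < y" using sin_ratio_2_gt_1[of 5] by (simp add: y_def)
  have "y * (y\<^sup>2 - 3) = 0" using sin_ratio_4[of 5] r' by (simp add: y_def eval_nat_numeral algebra_simps)
  then have y2: "y\<^sup>2 = 3" using y1 by simp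
  have r: "sin_ratio 5 1 = 1" "sin_ratio 5 3 = 2" "sin_ratio 5 4 = y" "sin_ratio 5 5 = 1"
    using r' sin_ratio_3[of 5] y2 by (simp_all add: y_def)
  have lo: "1.732 \<le> y" by (rule power2_le_imp_le) (use y1 y2 in \<open>simp_all add: power2_eq_square\<close>)
  have hi: "y \<le> 1.7321" by (rule power2_le_imp_le) (use y1 y2 in \<open>simp_all add: power2_eq_square\<close>)
  show ?thesis
  proof (rule suffridge_perturb[where c = "(!) [0, 1, 1.3856, 1.2, 0.6928, 0.2]" and \<epsilon> = "0.0002"])
    show "(\<Sum>k=1..5. \<bar>(1 - (real k - 1) / real 5) * sin_ratio 5 k - [0, 1, 1.3856, 1.2, 0.6928, 0.2] ! k\<bar>) \<le> 0.0002"
      unfolding sum_1_to r y_def[symmetric] using lo hi by (simp add: abs_if)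
  next
    fix z :: complex assume z: "cmod z = 1"
    define x where "x = Re z"
    define t where "t = x + 1"
    let ?S = "\<Sum>k=1..5. of_real ([0, 1, 1.3856, 1.2, 0.6928, 0.2] ! k) * z ^ k"
    define A where "A = 1.3856 + 1.2 * (2 * x) + 0.6928 * (4 * x\<^sup>2 - 1) + 0.2 * (8 * x^3 - 4 * x)"
    define B where "B = 1 - 1.2 - 0.6928 * (2 * x) + 0.2 * (1 - 4 * x\<^sup>2)"
    have "?S = of_real 1 * z + of_real 1.3856 * z^2 + of_real 1.2 * z^3 + of_real 0.6928 * z^4 + of_real 0.2 * z^5"
      unfolding sum_1_to by simp
    then have "(cmod ?S)\<^sup>2 = A\<^sup>2 + 2 * A * B * x + B\<^sup>2"
      using cmod_circle_poly[OF z refl refl, of 1 "1.3856" "1.2" "0.6928" "0.2" 0]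
      by (simp add: x_def A_def B_def)
    \<comment> \<open>The square absorbs the quartic and cubic terms in \<open>t\<close>; its
      constant \<open>1/50\<close> leaves a positive definite quadratic.\<close>
    also have "\<dots> = 0.318\<^sup>2 + 16/5 * (t\<^sup>2 - 1969/2500 * t + 1/50)\<^sup>2
        + (407599/1953125 * t\<^sup>2 + (- 1444/390625) * t + 6391/6250000)"
      unfolding A_def B_def t_def by (simp add: eval_nat_numeral field_simps)
    also have "\<dots> \<ge> 0.318\<^sup>2"
    proof -
      have "0 \<le> 407599/1953125 * t\<^sup>2 + (- 1444/390625) * t + 6391/6250000"
        by (rule quadratic_nonneg) (simp_all add: power2_eq_square)
      moreover have "0 \<le> 16/5 * (t\<^sup>2 - 1969/2500 * t + 1/50)\<^sup>2" by simp
      ultimately show ?thesis by linarith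
    qed
    finally show "0.3178 + 0.0002 \<le> cmod ?S"
      using power2_le_imp_le[of "0.318" "cmod ?S"] by simp
  qed
qed

lemma min_on_circle_suffridge_6_ge: "0.305 \<le> min_on_circle (suffridge_poly 6)"
proof -
  define y where "y = sin_ratio 6 2"
  have r: "sin_ratio 6 1 = 1" "sin_ratio 6 3 = y\<^sup>2 - 1" "sin_ratio 6 4 = y\<^sup>2 - 1"
      "sin_ratio 6 5 = y" "sin_ratio 6 6 = 1"
    using sin_ratio_1[of 6] sin_ratio_3[of 6] sin_ratio_sym[of 1 6] sin_ratio_sym[of 2 6]
      sin_ratio_sym[of 3 6] by (simp_all add: y_def)
  have y1: "1 < y" using sin_ratio_2_gt_1[of 6] by (simp add: y_def)
  have cubic: "y^3 - y\<^sup>2 - 2*y + 1 = 0" using sin_ratio_4[of 6] r by (simp add: y_def)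
  have yy: "1 < y\<^sup>2" using y1 by (simp add: power2_eq_square less_1_mult)
  \<comment> \<open>The left side is the difference of the cubic's values at \<open>y\<close> and
    \<open>a\<close>. Where the cofactor is positive, the sign of the cubic at \<open>a\<close>
    tells on which side of \<open>a\<close> the root \<open>y\<close> lies.\<close>
  have factor: "(y - a) * (y\<^sup>2 + (a - 1) * y + (a\<^sup>2 - a - 2)) = - (a^3 - a\<^sup>2 - 2*a + 1)" for a
    using cubic by (simp add: eval_nat_numeral algebra_simps)
  have lo: "1.8019 \<le> y"
  proof -
    have "0 < (y - 1.8019) * (y\<^sup>2 + (1.8019 - 1) * y + (1.8019\<^sup>2 - 1.8019 - 2))"
      unfolding factor by (simp add: eval_nat_numeral)
    moreover have "0 < y\<^sup>2 + (1.8019 - 1) * y + (1.8019\<^sup>2 - 1.8019 - 2)"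
      using y1 yy by (simp add: power2_eq_square)
    ultimately show ?thesis by (simp only: zero_less_mult_iff) linarith
  qed
  have hi: "y \<le> 1.802"
  proof -
    have "(y - 1.802) * (y\<^sup>2 + (1.802 - 1) * y + (1.802\<^sup>2 - 1.802 - 2)) < 0"
      unfolding factor by (simp add: eval_nat_numeral)
    moreover have "0 < y\<^sup>2 + (1.802 - 1) * y + (1.802\<^sup>2 - 1.802 - 2)"
      using y1 yy by (simp add: power2_eq_square)
    ultimately show ?thesis by (simp only: mult_less_0_iff) linarith
  qed
  have lo2: "3.2468 \<le> y\<^sup>2"
  proof -
    have "3.2468 \<le> (1.8019::real)\<^sup>2" by (simp add: power2_eq_square)
    also have "\<dots> \<le> y\<^sup>2" using lo by (intro power_mono) auto
    finally show ?thesis .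
  qed
  have hi2: "y\<^sup>2 \<le> 3.24721"
  proof -
    have "y\<^sup>2 \<le> (1.802::real)\<^sup>2" using hi y1 by (intro power_mono) auto
    also have "\<dots> \<le> 3.24721" by (simp add: power2_eq_square)
    finally show ?thesis .
  qed
  show ?thesis
  proof (rule suffridge_perturb[where c = "(!) [0, 1, 1.5016, 1.498, 1.1235, 0.6006, 1/6]" and \<epsilon> = "0.0005"])
    show "(\<Sum>k=1..6. \<bar>(1 - (real k - 1) / real 6) * sin_ratio 6 k - [0, 1, 1.5016, 1.498, 1.1235, 0.6006, 1/6] ! k\<bar>) \<le> 0.0005"
    proof -
      have "\<bar>5/6 * y - 1.5016\<bar> \<le> 0.0001" "\<bar>2/6 * y - 0.6006\<bar> \<le> 0.0001"
        using lo hi by (simp_all add: abs_if field_simps)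
      moreover have "\<bar>4/6 * (y\<^sup>2 - 1) - 1.498\<bar> \<le> 0.00015" "\<bar>3/6 * (y\<^sup>2 - 1) - 1.1235\<bar> \<le> 0.00015"
        using lo2 hi2 by (simp_all add: abs_if field_simps)
      ultimately show ?thesis
        unfolding sum_1_to r y_def[symmetric] by simp
    qed
  next
    fix z :: complex assume z: "cmod z = 1"
    define x where "x = Re z"
    define t where "t = x + 1"
    have t: "0 \<le> t" using z abs_Re_le_cmod[of z] by (simp add: t_def x_def abs_le_iff)
    let ?S = "\<Sum>k=1..6. of_real ([0, 1, 1.5016, 1.498, 1.1235, 0.6006, 1/6] ! k) * z ^ k"
    define A where "A = 1.5016 + 1.498 * (2 * x) + 1.1235 * (4 * x\<^sup>2 - 1) + 0.6006 * (8 * x^3 - 4 * x)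
      + 1/6 * (16 * x^4 - 12 * x\<^sup>2 + 1)"
    define B where "B = 1 - 1.498 - 1.1235 * (2 * x) + 0.6006 * (1 - 4 * x\<^sup>2) + 1/6 * (4 * x - 8 * x^3)"
    have "?S = of_real 1 * z + of_real 1.5016 * z^2 + of_real 1.498 * z^3 + of_real 1.1235 * z^4
        + of_real 0.6006 * z^5 + of_real (1/6) * z^6"
      unfolding sum_1_to by simp
    then have "(cmod ?S)\<^sup>2 = A\<^sup>2 + 2 * A * B * x + B\<^sup>2"
      using cmod_circle_poly[OF z refl refl, of 1 "1.5016" "1.498" "1.1235" "0.6006" "1/6"]
      by (simp add: x_def A_def B_def)
    \<comment> \<open>Again the constant part belongs to \<open>z = -1\<close>; the cofactor of
      \<open>t\<close> is a square plus a positive definite quadratic.\<close>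
    also have "\<dots> = 0.3055\<^sup>2 + 1837/2250000 + t * (16/3 * (t\<^sup>2 - 12237/10000 * t + 21/100)\<^sup>2
        + (138799/750000 * t\<^sup>2 + (- 111217/3125000) * t + 1566847/25000000))"
      unfolding A_def B_def t_def by (simp add: eval_nat_numeral field_simps)
    also have "\<dots> \<ge> 0.3055\<^sup>2"
      using mult_nonneg_nonneg[OF t add_nonneg_nonneg[of "16/3 * (t\<^sup>2 - 12237/10000 * t + 21/100)\<^sup>2",
          OF _ quadratic_nonneg[of "138799/750000" "- 111217/3125000" "1566847/25000000" t]]]
      by (simp add: power2_eq_square)
    finally show "0.305 + 0.0005 \<le> cmod ?S"
      using power2_le_imp_le[of "0.3055" "cmod ?S"] by simp
  qed
qed

theorem mainTheorem1:
  shows "(\<forall>n\<in>{1, 2}. dimitrov_extremal n (suffridge_poly n)) \<and>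
    (\<forall>n\<in>{3, 4, 5, 6}. \<not> dimitrov_extremal n (suffridge_poly n) \<and>
       (\<exists>p\<in>univalent_polys n. min_on_circle p < min_on_circle (suffridge_poly n)))"
proof -
  \<comment> \<open>At \<open>-1\<close> the competitors of degrees 3 to 6 have moduli
    \<open>5/13\<close>, \<open>485/1422\<close>, \<open>19/60\<close> and \<open>343/1126\<close>,
    about 0.3846, 0.3411, 0.3167 and 0.3046, each just below the Suffridge bound.\<close>
  have 3: "\<exists>p\<in>univalent_polys 3. min_on_circle p < min_on_circle (suffridge_poly 3)"
    using min_on_circle_le[of "-1" "[:0, 1, 12/13, 4/13:]"] min_on_circle_suffridge_3_ge
    by (intro bexI[OF _ competitor_3_univalent]) simp
  have 4: "\<exists>p\<in>univalent_polys 4. min_on_circle p < min_on_circle (suffridge_poly 4)"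
    using min_on_circle_le[of "-1" "[:0, 1, 521/474, 400/711, 29/237:]"] min_on_circle_suffridge_4_ge
    by (intro bexI[OF _ competitor_4_univalent]) simp
  have 5: "\<exists>p\<in>univalent_polys 5. min_on_circle p < min_on_circle (suffridge_poly 5)"
    using min_on_circle_le[of "-1" "[:0, 1, 23/18, 8/9, 13/36, 1/15:]"] min_on_circle_suffridge_5_ge
    by (intro bexI[OF _ competitor_5_univalent]) simp
  have 6: "\<exists>p\<in>univalent_polys 6. min_on_circle p < min_on_circle (suffridge_poly 6)"
    using min_on_circle_le[of "-1" "[:0, 1, 764/563, 586/563, 571/1126, 83/563, 11/563:]"] min_on_circle_suffridge_6_ge
    by (intro bexI[OF _ competitor_6_univalent]) simp
  show ?thesis
    using suffridge_1_extremal suffridge_2_extremal 3 4 5 6 not_dimitrov_extremalI by blast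
qed

end
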